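(* There exist an absolute constant $K>0$ and real numbers $c(N,D)$, defined for all integers $N\ge 2$ and $D\ge 1$, with $$\left|c(N,D)-\frac{3D+1}{48}\,N^{D+2}\right|\le K\,D\,N^{D+1},$$ such that for all integers $N\ge2$, $D\ge1$ and every real $J\neq 0$, the ferro- or antiferromagnetic Heisenberg model on the $D$-dimensional rectangular lattice, $N$ spins wide in each dimension, with periodic boundary conditions (so $N_{\mathrm{tot}}=N^D$ qubits) satisfies the operator inequality $$\Delta\vec{S}^2\;\le\; c(N,D)\,\frac{\Delta H}{4J}.$$ That is, the inequality holds with $c=\frac{3D+1}{48}N^{D+2}+O(DN^{D+1})$.
   Context: The lattice with periodic boundary conditions is the graph with vertex set $(\mathbb{Z}/N\mathbb{Z})^D$ in which two distinct sites are joined by an edge iff they differ by $\pm 1$ (mod $N$) in exactly one coordinate and agree in all the others; let $\mathcal{E}$ be its edge set. Each vertex $i$ carries a qubit $\mathbb{C}^2$ with Pauli vector $\vec{\sigma}_i=(\sigma_i^{\mathrm{x}},\sigma_i^{\mathrm{y}},\sigma_i^{\mathrm{z}})$ (acting as the identity on the other qubits), and $\vec\sigma_i\cdot\vec\sigma_k=\sigma_i^{\mathrm{x}}\sigma_k^{\mathrm{x}}+\sigma_i^{\mathrm{y}}\sigma_k^{\mathrm{y}}+\sigma_i^{\mathrm{z}}\sigma_k^{\mathrm{z}}$. The Heisenberg Hamiltonian is $H=-J\sum_{(i,k)\in\mathcal{E}}\vec{\sigma}_i\cdot\vec{\sigma}_k$, where each edge is counted once. Put $E_*=-J|\mathcal{E}|$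 and $\Delta H=H-E_* I=-J\sum_{(i,k)\in\mathcal{E}}(\vec\sigma_i\cdot\vec\sigma_k-I)$. The total spin is $\vec{S}=\sum_i\vec{\sigma}_i/2$, so that $\vec{S}^2=\frac14\sum_i\sum_k\vec\sigma_i\cdot\vec\sigma_k$, and $\Delta\vec{S}^2=\frac{N_{\mathrm{tot}}}{2}\left(\frac{N_{\mathrm{tot}}}{2}+1\right)I-\vec{S}^2$ with $N_{\mathrm{tot}}=N^D$. For Hermitian operators $A,B$, $A\le B$ means that $B-A$ is positive semidefinite. *)

theory Defs
  imports Complex_Main "HOL-Library.FuncSet" "HOL-Number_Theory.Cong"
begin

(* Residues mod N are represented by the naturals below N; a site is a D-tuple of them. *)
definition lattice :: "nat \<Rightarrow> nat \<Rightarrow> (nat \<Rightarrow> nat) set" where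
  "lattice N D = {..<D} \<rightarrow>\<^sub>E {..<N}"

definition adjacent :: "nat \<Rightarrow> nat \<Rightarrow> (nat \<Rightarrow> nat) \<Rightarrow> (nat \<Rightarrow> nat) \<Rightarrow> bool" where
  "adjacent N D i k \<longleftrightarrow>
     i \<noteq> k \<and>
     (\<exists>a<D. ([int (i a) = int (k a) + 1] (mod int N) \<or> [int (i a) = int (k a) - 1] (mod int N)) \<and>
            (\<forall>b<D. b \<noteq> a \<longrightarrow> i b = k b))"

(* Edges are unordered pairs; for N = 2 the sites k + 1 and k - 1 coincide and give one edge. *)
definition edges :: "nat \<Rightarrow> nat \<Rightarrow> (nat \<Rightarrow> nat) set set" where
  "edges N D = {{i, k} | i k. i \<in> lattice N D \<and> k \<in> lattice N D \<and> adjacent N D i k}"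

(* A vector of the tensor product of qubits over the finite site set V is given by its
   amplitudes in the computational basis, which is indexed by V \<rightarrow>\<^sub>E UNIV.  Amplitudes at
   other arguments are junk: they affect neither the inner product below nor, for the
   operators below, the amplitudes on the basis. *)
type_synonym 'v state = "('v \<Rightarrow> bool) \<Rightarrow> complex"
type_synonym 'v oper = "'v state \<Rightarrow> 'v state"

definition basis :: "'v set \<Rightarrow> ('v \<Rightarrow> bool) set" where
  "basis V = V \<rightarrow>\<^sub>E UNIV"

definition inner_prod :: "'v set \<Rightarrow> 'v state \<Rightarrow> 'v state \<Rightarrow> complex" where
  "inner_prod V \<phi> \<psi> = (\<Sum>s\<in>basis V. cnj (\<phi> s) * \<psi> s)"

definition hermitian_op :: "'v set \<Rightarrow> 'v oper \<Rightarrow> bool" where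
  "hermitian_op V A \<longleftrightarrow> (\<forall>\<phi> \<psi>. inner_prod V \<phi> (A \<psi>) = inner_prod V (A \<phi>) \<psi>)"

definition positive_semidef :: "'v set \<Rightarrow> 'v oper \<Rightarrow> bool" where
  "positive_semidef V A \<longleftrightarrow> hermitian_op V A \<and> (\<forall>\<psi>. 0 \<le> Re (inner_prod V \<psi> (A \<psi>)))"

definition op_le :: "'v set \<Rightarrow> 'v oper \<Rightarrow> 'v oper \<Rightarrow> bool" where
  "op_le V A B \<longleftrightarrow> positive_semidef V (\<lambda>\<psi> s. B \<psi> s - A \<psi> s)"

datatype axis = AxisX | AxisY | AxisZ

(* Matrix entries (row, column); False is the first basis vector (spin up), True the second. *)
fun pauli :: "axis \<Rightarrow> bool \<Rightarrow> bool \<Rightarrow> complex" where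
  "pauli AxisX b b' = (if b = b' then 0 else 1)"
| "pauli AxisY b b' = (if b = b' then 0 else if b then \<i> else - \<i>)"
| "pauli AxisZ b b' = (if b \<noteq> b' then 0 else if b then - 1 else 1)"

(* The Pauli matrix acting on the tensor factor v and as the identity on the others. *)
definition sigma :: "axis \<Rightarrow> 'v \<Rightarrow> 'v oper" where
  "sigma a v \<psi> = (\<lambda>s. \<Sum>b\<in>UNIV. pauli a (s v) b * \<psi> (s(v := b)))"

definition sigma_dot :: "'v \<Rightarrow> 'v \<Rightarrow> 'v oper" where
  "sigma_dot v w \<psi> = (\<lambda>s. \<Sum>a\<in>{AxisX, AxisY, AxisZ}. sigma a v (sigma a w \<psi>) s)"

(* For an unordered edge e = {v, w} both orders are summed and halved, so this is
   sigma_dot v w, as the Pauli operators at distinct sites commute. *)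
definition edge_dot :: "'v set \<Rightarrow> 'v oper" where
  "edge_dot e \<psi> = (\<lambda>s. (\<Sum>v\<in>e. \<Sum>w\<in>e - {v}. sigma_dot v w \<psi> s) / 2)"

definition heisenberg :: "real \<Rightarrow> nat \<Rightarrow> nat \<Rightarrow> (nat \<Rightarrow> nat) oper" where
  "heisenberg J N D \<psi> = (\<lambda>s. - of_real J * (\<Sum>e\<in>edges N D. edge_dot e \<psi> s))"

definition E_star :: "real \<Rightarrow> nat \<Rightarrow> nat \<Rightarrow> real" where
  "E_star J N D = - J * real (card (edges N D))"

definition delta_H :: "real \<Rightarrow> nat \<Rightarrow> nat \<Rightarrow> (nat \<Rightarrow> nat) oper" where
  "delta_H J N D \<psi> = (\<lambda>s. heisenberg J N D \<psi> s - of_real (E_star J N D) * \<psi> s)"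

definition total_spin :: "'v set \<Rightarrow> axis \<Rightarrow> 'v oper" where
  "total_spin V a \<psi> = (\<lambda>s. \<Sum>v\<in>V. sigma a v \<psi> s / 2)"

definition spin_sq :: "'v set \<Rightarrow> 'v oper" where
  "spin_sq V \<psi> = (\<lambda>s. \<Sum>a\<in>{AxisX, AxisY, AxisZ}. total_spin V a (total_spin V a \<psi>) s)"

definition delta_spin_sq :: "nat \<Rightarrow> nat \<Rightarrow> (nat \<Rightarrow> nat) oper" where
  "delta_spin_sq N D \<psi> =
     (\<lambda>s. of_real (real (N ^ D) / 2 * (real (N ^ D) / 2 + 1)) * \<psi> s - spin_sq (lattice N D) \<psi> s)"

end

theory Submission
  imports Defs "HOL-Analysis.L2_Norm" "HOL-Analysis.Convex"
begin

text \<open>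
  At distinct sites \<open>\<sigma>\<^sub>v \<cdot> \<sigma>\<^sub>w = 2P - 1\<close> with \<open>P\<close> the swap of the two qubits, so both operators
  are nonnegative combinations of the \<open>1 - P\<close>: over all pairs of sites for the spin, over the
  edges for the energy.  For a fixed state, the square root of the quadratic form of \<open>1 - P\<close> is
  a pseudometric on the sites.  For any pseudometric \<open>d\<close> on the torus, the \<open>L\<^sup>2\<close> norm
  over \<open>i\<close> of \<open>d(i, i + f)\<close> is subadditive in the displacement \<open>f\<close>, hence at most the sum of
  \<open>l(f\<^sub>a) e\<^sub>a\<close> over the axes \<open>a\<close>, where \<open>l(m) = min m (N - m)\<close> and \<open>e\<^sub>a\<close> is the norm of the
  unit step along \<open>a\<close>.  Cauchy-Schwarz with weights \<open>l(f\<^sub>a)\<close> and summation over \<open>f\<close>, where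
  \<open>l\<close> has mean about \<open>N/4\<close> and mean square about \<open>N\<^sup>2/12\<close>, give the leading coefficient
  \<open>1/12 + (D - 1)/16 = (3D + 1)/48\<close>.
\<close>

section \<open>Swaps of two qubits\<close>

definition swap_sites :: "'v \<Rightarrow> 'v \<Rightarrow> ('v \<Rightarrow> 'b) \<Rightarrow> 'v \<Rightarrow> 'b" where
  "swap_sites v w s = s(v := s w, w := s v)"

lemma swap_sites_involution [simp]: "swap_sites v w (swap_sites v w s) = s"
  by (auto simp: swap_sites_def fun_eq_iff)

lemma swap_sites_same [simp]: "swap_sites v v s = s"
  by (auto simp: swap_sites_def fun_eq_iff)

lemma swap_sites_commute: "swap_sites v w = swap_sites w v"
  by (auto simp: swap_sites_def fun_eq_iff)

lemma swap_sites_equal: "s v = s w \<Longrightarrow> swap_sites v w s = s"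
  by (auto simp: swap_sites_def fun_eq_iff)

text \<open>The two swaps make a 3-cycle, which differs from the swap of \<open>x\<close> and
  \<open>z\<close> only by exchanging the equal bits \<open>s y\<close> and
  \<open>s z\<close>.\<close>

lemma swap_sites_compose: "s y = s z \<Longrightarrow> swap_sites y z (swap_sites x y s) = swap_sites x z s"
  by (rule ext) (simp add: swap_sites_def fun_upd_apply)

lemma swap_sites_basis:
  assumes "v \<in> V" "w \<in> V" "s \<in> basis V"
  shows "swap_sites v w s \<in> basis V"
  using assms by (auto simp: swap_sites_def basis_def PiE_def extensional_def)

lemma sum_basis_swap_sites:
  assumes "v \<in> V" "w \<in> V"
  shows "(\<Sum>s\<in>basis V. g (swap_sites v w s)) = (\<Sum>s\<in>basis V. g s)"
  by (rule sum.reindex_bij_witness[of _ "swap_sites v w" "swap_sites v w"])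
     (auto simp: swap_sites_basis[OF assms])

section \<open>Spin operators as swaps, and their quadratic forms\<close>

lemma sigma_dot_distinct:
  assumes "v \<noteq> w"
  shows "sigma_dot v w \<psi> s = 2 * \<psi> (swap_sites v w s) - \<psi> s"
proof -
  have e: "s(v := s v) = s" "s(w := s w) = s" "s(v := s v, w := s w) = s" by auto
  \<comment> \<open>On equal bits the X and Y terms cancel and Z gives 1; on opposite bits X and Y
    each give the swapped amplitude and Z gives -1.\<close>
  show ?thesis
    using assms e
    by (cases "s v"; cases "s w")
       (auto simp: sigma_dot_def sigma_def UNIV_bool swap_sites_def fun_upd_twist algebra_simps)
qed

lemma sigma_dot_same: "sigma_dot v v \<psi> s = 3 * \<psi> s"
proof -
  have e: "s(v := s v) = s" by auto
  show ?thesis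
    using e by (cases "s v") (auto simp: sigma_dot_def sigma_def UNIV_bool algebra_simps)
qed

lemma sigma_sum:
  "sigma a v (\<lambda>s. \<Sum>w\<in>V. f w s / 2) s = (\<Sum>w\<in>V. sigma a v (f w) s) / 2"
  by (simp add: sigma_def UNIV_bool sum.distrib sum_distrib_left sum_divide_distrib add_divide_distrib)

lemma spin_sq_eq_sigma_dot:
  "spin_sq V \<psi> s = (\<Sum>v\<in>V. \<Sum>w\<in>V. sigma_dot v w \<psi> s) / 4"
proof -
  have "total_spin V a (total_spin V a \<psi>) s = (\<Sum>v\<in>V. \<Sum>w\<in>V. sigma a v (sigma a w \<psi>) s) / 4" for a
    unfolding total_spin_def sigma_sum by (simp add: sum_divide_distrib)
  then show ?thesis
    by (simp add: spin_sq_def sigma_dot_def sum.distrib add_divide_distrib del: eq_divide_eq_numeral1)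
qed

lemma spin_sq_eq_swap_sites:
  assumes "finite V"
  shows "of_real (real (card V) / 2 * (real (card V) / 2 + 1)) * \<psi> s - spin_sq V \<psi> s
    = (\<Sum>v\<in>V. \<Sum>w\<in>V. \<psi> s - \<psi> (swap_sites v w s)) / 2"
proof -
  \<comment> \<open>On the diagonal the swap formula would give 1 instead of 3. The excess 2 per
    site turns n^2 / 4 into n / 2 * (n / 2 + 1), so the constant in \<open>delta_spin_sq\<close>
    cancels.\<close>
  have "sigma_dot v w \<psi> s = (if w = v then 2 * \<psi> s else 0) + \<psi> s - 2 * (\<psi> s - \<psi> (swap_sites v w s))"
    for v w by (simp add: sigma_dot_distinct sigma_dot_same)
  then have "(\<Sum>v\<in>V. \<Sum>w\<in>V. sigma_dot v w \<psi> s)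
      = (\<Sum>v\<in>V. \<Sum>w\<in>V. (if w = v then 2 * \<psi> s else 0) + \<psi> s - 2 * (\<psi> s - \<psi> (swap_sites v w s)))"
    by (simp only:)
  then have e: "(\<Sum>v\<in>V. \<Sum>w\<in>V. sigma_dot v w \<psi> s) = of_nat (card V) * (2 * \<psi> s)
      + of_nat (card V) * (of_nat (card V) * \<psi> s) - 2 * (\<Sum>v\<in>V. \<Sum>w\<in>V. \<psi> s - \<psi> (swap_sites v w s))"
    using assms
    by (simp only: sum.distrib sum_subtractf sum_distrib_left[symmetric] sum.delta) simp
  show ?thesis
    unfolding spin_sq_eq_sigma_dot e by (simp add: field_simps)
qed

text \<open>The swap P permutes the basis and is a self-adjoint involution, so 1 - P is half of its
  own square.\<close>

lemma inner_prod_swap_sites: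
  assumes "v \<in> V" "w \<in> V"
  shows "inner_prod V \<phi> (\<lambda>s. \<psi> s - \<psi> (swap_sites v w s))
    = (\<Sum>s\<in>basis V. cnj (\<phi> s - \<phi> (swap_sites v w s)) * (\<psi> s - \<psi> (swap_sites v w s))) / 2"
proof -
  let ?t = "swap_sites v w"
  have "(\<Sum>s\<in>basis V. cnj (\<phi> (?t s)) * (\<psi> (?t s) - \<psi> s)) = (\<Sum>s\<in>basis V. cnj (\<phi> s) * (\<psi> s - \<psi> (?t s)))"
    using sum_basis_swap_sites[OF assms, of "\<lambda>s. cnj (\<phi> s) * (\<psi> s - \<psi> (?t s))"] by simp
  moreover have "(\<Sum>s\<in>basis V. cnj (\<phi> s - \<phi> (?t s)) * (\<psi> s - \<psi> (?t s)))
    = (\<Sum>s\<in>basis V. cnj (\<phi> s) * (\<psi> s - \<psi> (?t s))) + (\<Sum>s\<in>basis V. cnj (\<phi> (?t s)) * (\<psi> (?t s) - \<psi> s))"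
    unfolding sum.distrib[symmetric] by (rule sum.cong) (auto simp: algebra_simps)
  ultimately show ?thesis by (simp add: Defs.inner_prod_def)
qed

text \<open>By \<open>inner_prod_swap_sites\<close>, its square is twice the quadratic form of 1 - P
  at \<open>\<psi>\<close>.\<close>

definition swap_dist :: "'v set \<Rightarrow> 'v state \<Rightarrow> 'v \<Rightarrow> 'v \<Rightarrow> real" where
  "swap_dist V \<psi> v w = L2_set (\<lambda>s. cmod (\<psi> s - \<psi> (swap_sites v w s))) (basis V)"

lemma swap_dist_sq:
  "(swap_dist V \<psi> v w)\<^sup>2 = (\<Sum>s\<in>basis V. (cmod (\<psi> s - \<psi> (swap_sites v w s)))\<^sup>2)"
  by (simp add: swap_dist_def L2_set_def sum_nonneg)

text \<open>Reduces the operator inequality to a real inequality between weighted sums of squared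
  distances. Single weights may be negative: they are real, which makes the form \<open>F\<close>
  Hermitian, and \<open>F \<psi> \<psi>\<close> is half the sum assumed nonnegative.\<close>

lemma positive_semidef_swap_sites:
  fixes m :: "'v \<Rightarrow> 'v \<Rightarrow> real"
  assumes "\<And>\<psi>. 0 \<le> (\<Sum>v\<in>V. \<Sum>w\<in>V. m v w * (swap_dist V \<psi> v w)\<^sup>2)"
  shows "positive_semidef V (\<lambda>\<psi> s. \<Sum>v\<in>V. \<Sum>w\<in>V. of_real (m v w) * (\<psi> s - \<psi> (swap_sites v w s)))"
    (is "positive_semidef V ?T")
proof -
  define F where "F \<phi> \<psi> = (\<Sum>v\<in>V. \<Sum>w\<in>V. of_real (m v w) *
    (\<Sum>s\<in>basis V. cnj (\<phi> s - \<phi> (swap_sites v w s)) * (\<psi> s - \<psi> (swap_sites v w s))) / 2)" for \<phi> \<psi>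
  have T: "inner_prod V \<phi> (?T \<psi>) = F \<phi> \<psi>" for \<phi> \<psi>
  proof -
    have "inner_prod V \<phi> (?T \<psi>) = (\<Sum>s\<in>basis V. \<Sum>v\<in>V. \<Sum>w\<in>V. of_real (m v w) * (cnj (\<phi> s) * (\<psi> s - \<psi> (swap_sites v w s))))"
      by (simp add: Defs.inner_prod_def sum_distrib_left algebra_simps)
    also have "\<dots> = (\<Sum>v\<in>V. \<Sum>s\<in>basis V. \<Sum>w\<in>V. of_real (m v w) * (cnj (\<phi> s) * (\<psi> s - \<psi> (swap_sites v w s))))"
      by (rule sum.swap)
    also have "\<dots> = (\<Sum>v\<in>V. \<Sum>w\<in>V. of_real (m v w) * inner_prod V \<phi> (\<lambda>s. \<psi> s - \<psi> (swap_sites v w s)))"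
      by (rule sum.cong[OF refl], subst sum.swap) (simp add: Defs.inner_prod_def sum_distrib_left)
    also have "\<dots> = F \<phi> \<psi>"
      by (simp add: F_def inner_prod_swap_sites)
    finally show ?thesis .
  qed
  have "F \<phi> \<psi> = cnj (F \<psi> \<phi>)" for \<phi> \<psi>
    by (simp add: F_def mult.commute)
  moreover have "inner_prod V (?T \<phi>) \<psi> = cnj (inner_prod V \<psi> (?T \<phi>))" for \<phi> \<psi>
    by (simp add: Defs.inner_prod_def mult.commute)
  ultimately have "inner_prod V \<phi> (?T \<psi>) = inner_prod V (?T \<phi>) \<psi>" for \<phi> \<psi>
    by (metis T)
  moreover have "0 \<le> Re (inner_prod V \<psi> (?T \<psi>))" for \<psi>
  proof -
    have "F \<psi> \<psi> = of_real ((\<Sum>v\<in>V. \<Sum>w\<in>V. m v w * (swap_dist V \<psi> v w)\<^sup>2) / 2)"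
      unfolding F_def swap_dist_sq mult.commute[of "cnj _"] complex_norm_square[symmetric]
      by (simp add: sum_divide_distrib)
    then show ?thesis using assms[of \<psi>] by (simp only: T Re_complex_of_real)
  qed
  ultimately show ?thesis by (simp add: positive_semidef_def hermitian_op_def)
qed

section \<open>The swap pseudometric\<close>

lemma swap_dist_nonneg: "0 \<le> swap_dist V \<psi> v w"
  by (simp add: swap_dist_def)

lemma swap_dist_same: "swap_dist V \<psi> v v = 0"
  by (simp add: swap_dist_def L2_set_def)

lemma swap_dist_commute: "swap_dist V \<psi> v w = swap_dist V \<psi> w v"
  unfolding swap_dist_def swap_sites_commute[of v w] ..

text \<open>This is where spin 1/2 enters: if \<open>s x \<noteq> s z\<close>, then \<open>s y\<close> equals one of the two, so one of
  the swaps \<open>x y\<close>, \<open>y z\<close> fixes \<open>s\<close>, and applying the other one first and then this one gives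
  the swap \<open>x z\<close> of \<open>s\<close>.\<close>
lemma swap_dist_triangle:
  assumes "x \<in> V" "y \<in> V" "z \<in> V"
  shows "swap_dist V \<psi> x z \<le> swap_dist V \<psi> x y + swap_dist V \<psi> y z"
proof -
  define p where "p s = cmod (\<psi> s - \<psi> (swap_sites x y s))" for s
  define r where "r s = cmod (\<psi> s - \<psi> (swap_sites y z s))" for s
  \<comment> \<open>One bound serves all cases: a swap that fixes \<open>s\<close> leaves the other
    term at \<open>s\<close>. The swapped arguments do no harm, as swaps permute the basis and
    preserve the L2 norms.\<close>
  have le: "cmod (\<psi> s - \<psi> (swap_sites x z s)) \<le> p (swap_sites y z s) + r (swap_sites x y s)" for s
  proof -
    consider "s x = s z" | "s x \<noteq> s z" "s y = s z" | "s x \<noteq> s z" "s x = s y" by blast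
    then show ?thesis
    proof cases
      case 1
      then have "swap_sites x z s = s" by (rule swap_sites_equal)
      then show ?thesis by (simp add: p_def r_def)
    next
      case 2
      then have "swap_sites y z s = s" "swap_sites y z (swap_sites x y s) = swap_sites x z s"
        by (simp_all only: swap_sites_equal swap_sites_compose)
      then show ?thesis
        using norm_triangle_ineq[of "\<psi> s - \<psi> (swap_sites x y s)" "\<psi> (swap_sites x y s) - \<psi> (swap_sites x z s)"]
        by (simp add: p_def r_def)
    next
      case 3
      then have "swap_sites x y s = s" "swap_sites x y (swap_sites y z s) = swap_sites x z s"
        using swap_sites_compose[of s y x z] by (simp_all add: swap_sites_equal swap_sites_commute)
      then show ?thesis
        using norm_triangle_ineq[of "\<psi> s - \<psi> (swap_sites y z s)" "\<psi> (swap_sites y z s) - \<psi> (swap_sites x z s)"]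
        by (simp add: p_def r_def)
    qed
  qed
  have "swap_dist V \<psi> x z \<le> L2_set (\<lambda>s. p (swap_sites y z s) + r (swap_sites x y s)) (basis V)"
    unfolding swap_dist_def by (rule L2_set_mono) (use le in auto)
  also have "\<dots> \<le> L2_set (\<lambda>s. p (swap_sites y z s)) (basis V) + L2_set (\<lambda>s. r (swap_sites x y s)) (basis V)"
    by (rule L2_set_triangle_ineq)
  also have "\<dots> = swap_dist V \<psi> x y + swap_dist V \<psi> y z"
    using sum_basis_swap_sites[of y V z "\<lambda>s. (p s)\<^sup>2"] sum_basis_swap_sites[of x V y "\<lambda>s. (r s)\<^sup>2"] assms
    by (simp add: swap_dist_def L2_set_def p_def r_def)
  finally show ?thesis .
qed

section \<open>Pseudometrics on the discrete torus\<close>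

text \<open>Displacements are arbitrary functions, reduced mod \<open>N\<close> only after being
  added to the site, so that they add pointwise.\<close>

definition shift :: "nat \<Rightarrow> nat \<Rightarrow> (nat \<Rightarrow> nat) \<Rightarrow> (nat \<Rightarrow> nat) \<Rightarrow> nat \<Rightarrow> nat" where
  "shift N D f i = (\<lambda>a\<in>{..<D}. (i a + f a) mod N)"

definition axis_shift :: "nat \<Rightarrow> nat \<Rightarrow> nat \<Rightarrow> nat" where
  "axis_shift a m = (\<lambda>b. if b = a then m else 0)"

definition cyclic_abs :: "nat \<Rightarrow> nat \<Rightarrow> nat" where
  "cyclic_abs N m = min m (N - m)"

section \<open>Translations of the lattice\<close>

lemma finite_lattice [simp]: "finite (lattice N D)"
  by (simp add: lattice_def finite_PiE)

lemma card_lattice: "card (lattice N D) = N ^ D"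
  by (simp add: lattice_def card_PiE)

lemma shift_lattice: "N > 0 \<Longrightarrow> shift N D f i \<in> lattice N D"
  by (auto simp: shift_def lattice_def)

lemma shift_shift: "shift N D g (shift N D f i) = shift N D (\<lambda>a. f a + g a) i"
  by (auto simp: shift_def fun_eq_iff mod_add_left_eq add.assoc)

lemma shift_cong:
  assumes "\<And>a. a < D \<Longrightarrow> f a mod N = g a mod N"
  shows "shift N D f = shift N D g"
  using assms by (auto simp: shift_def fun_eq_iff) (metis mod_add_right_eq)

lemma shift_id:
  assumes "i \<in> lattice N D" "\<And>a. a < D \<Longrightarrow> f a mod N = 0"
  shows "shift N D f i = i"
proof
  fix a
  show "shift N D f i a = i a"
  proof (cases "a < D")
    case True
    then have "i a < N" using assms(1) by (auto simp: lattice_def)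
    moreover have "(i a + f a) mod N = i a mod N"
      using assms(2)[OF True] by (metis add.right_neutral mod_add_right_eq)
    ultimately show ?thesis using True by (simp add: shift_def)
  next
    case False
    then show ?thesis using assms(1) by (auto simp: shift_def lattice_def PiE_def extensional_def)
  qed
qed

lemma add_uminus_mod: "(f + (N - f mod N)) mod N = 0" if "N > 0" for f N :: nat
proof -
  have "(f + (N - f mod N)) mod N = (f mod N + (N - f mod N)) mod N" by (simp add: mod_add_left_eq)
  also have "f mod N + (N - f mod N) = N" using mod_less_divisor[OF that, of f] by linarith
  finally show ?thesis by simp
qed

lemma sum_lattice_shift:
  assumes "N > 0"
  shows "(\<Sum>i\<in>lattice N D. g (shift N D f i)) = (\<Sum>i\<in>lattice N D. g i)"
  \<comment> \<open>The inverse displacement reduces \<open>f a\<close> mod \<open>N\<close> first,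
    because subtraction of naturals truncates.\<close>
  by (rule sum.reindex_bij_witness[of _ "shift N D (\<lambda>a. N - f a mod N)" "shift N D f"])
     (auto simp: shift_lattice[OF assms] shift_shift intro!: shift_id,
      auto simp: add_uminus_mod[OF assms] add.commute)

text \<open>Site and displacement enter \<open>shift\<close> symmetrically, so this is a translation
  of the summation variable by \<open>i\<close>.\<close>

lemma sum_lattice_displacement:
  assumes "N > 0" "i \<in> lattice N D"
  shows "(\<Sum>f\<in>lattice N D. g (shift N D f i)) = (\<Sum>k\<in>lattice N D. g k)"
proof -
  have "shift N D f i = shift N D i f" for f by (auto simp: shift_def add.commute)
  then show ?thesis by (simp add: sum_lattice_shift[OF assms(1)])
qed

section \<open>Coordinate sums and moments of the cyclic distance\<close>

lemma sum_lattice_coord: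
  fixes p :: "nat \<Rightarrow> real"
  assumes "a < D"
  shows "(\<Sum>f\<in>lattice N D. p (f a)) = real N ^ (D - 1) * (\<Sum>x<N. p x)"
proof -
  let ?F = "\<lambda>c x. if c = a then p x else 1"
  have "(\<Sum>f\<in>lattice N D. \<Prod>c\<in>{..<D}. ?F c (f c)) = (\<Prod>c\<in>{..<D}. \<Sum>x<N. ?F c x)"
    unfolding lattice_def by (rule prod_sum_PiE[symmetric]) auto
  then show ?thesis
    using assms by (simp add: prod.remove[of "{..<D}" a])
qed

lemma sum_lattice_two_coords:
  fixes p q :: "nat \<Rightarrow> real"
  assumes "a < D" "b < D" "a \<noteq> b"
  shows "(\<Sum>f\<in>lattice N D. p (f a) * q (f b)) = real N ^ (D - 2) * (\<Sum>x<N. p x) * (\<Sum>x<N. q x)"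
proof -
  let ?F = "\<lambda>c x. if c = a then p x else if c = b then q x else 1"
  have "(\<Sum>f\<in>lattice N D. \<Prod>c\<in>{..<D}. ?F c (f c)) = (\<Prod>c\<in>{..<D}. \<Sum>x<N. ?F c x)"
    unfolding lattice_def by (rule prod_sum_PiE[symmetric]) auto
  moreover have "(\<Prod>c\<in>{..<D}. g c) = g a * (g b * (\<Prod>c\<in>{..<D} - {a} - {b}. g c))" for g :: "nat \<Rightarrow> real"
    using assms by (simp add: prod.remove[of "{..<D}" a] prod.remove[of "{..<D} - {a}" b])
  moreover have "card ({..<D} - {a} - {b}) = D - 2"
    using assms by (simp add: card_Diff_singleton_if)
  ultimately show ?thesis
    using assms by (simp add: mult_ac)
qed

text \<open>Passing from \<open>N\<close> to \<open>N + 2\<close> raises every distance by one and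
  adds a zero at each end. Including \<open>m = N\<close>, where the distance is 0, makes this
  symmetric.\<close>

lemma sum_cyclic_abs_Suc_Suc:
  fixes g :: "nat \<Rightarrow> real"
  shows "(\<Sum>m\<le>Suc (Suc N). g (cyclic_abs (Suc (Suc N)) m)) = 2 * g 0 + (\<Sum>m\<le>N. g (Suc (cyclic_abs N m)))"
proof -
  have "(\<Sum>m\<le>Suc N. g (cyclic_abs (Suc (Suc N)) m)) = g 0 + (\<Sum>m\<le>N. g (cyclic_abs (Suc (Suc N)) (Suc m)))"
    by (subst sum.atMost_Suc_shift) (simp add: cyclic_abs_def)
  moreover have "(\<Sum>m\<le>N. g (cyclic_abs (Suc (Suc N)) (Suc m))) = (\<Sum>m\<le>N. g (Suc (cyclic_abs N m)))"
    by (rule sum.cong) (auto simp: cyclic_abs_def Suc_diff_le)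
  ultimately show ?thesis by (simp add: cyclic_abs_def)
qed

lemma sum_cyclic_abs_le:
  "(\<Sum>m<N. real (cyclic_abs N m)) \<le> real N ^ 2 / 4"
  "(\<Sum>m<N. real (cyclic_abs N m) ^ 2) \<le> real N ^ 3 / 12 + real N / 6"
proof -
  \<comment> \<open>The bounds are proved jointly, as expanding (l + 1)^2 brings the first moment
    into the second. Both are equalities for even \<open>N\<close>.\<close>
  have "(\<Sum>m\<le>N. real (cyclic_abs N m)) \<le> real N ^ 2 / 4 \<and>
    (\<Sum>m\<le>N. real (cyclic_abs N m) ^ 2) \<le> real N ^ 3 / 12 + real N / 6"
  proof (induction N rule: induct_nat_012)
    case 0
    then show ?case by (simp add: cyclic_abs_def)
  next
    case 1
    then show ?case by (simp add: cyclic_abs_def)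
  next
    case (ge2 N)
    then show ?case
      unfolding sum_cyclic_abs_Suc_Suc[where g = real] sum_cyclic_abs_Suc_Suc[where g = "\<lambda>x. real x ^ 2"]
      by (elim conjE) (simp add: sum.distrib sum_distrib_left[symmetric] power2_eq_square power3_eq_cube field_simps)
  qed
  then show "(\<Sum>m<N. real (cyclic_abs N m)) \<le> real N ^ 2 / 4"
    "(\<Sum>m<N. real (cyclic_abs N m) ^ 2) \<le> real N ^ 3 / 12 + real N / 6"
    by (auto simp: lessThan_Suc_atMost[symmetric] cyclic_abs_def)
qed

text \<open>The triangle inequality is asked for lattice sites only, matching
  \<open>swap_dist_triangle\<close>, where the swaps must permute the basis.\<close>

locale torus_pseudometric =
  fixes N D :: nat and d :: "(nat \<Rightarrow> nat) \<Rightarrow> (nat \<Rightarrow> nat) \<Rightarrow> real"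
  assumes N_pos: "N > 0"
    and nonneg: "0 \<le> d i k"
    and same: "d i i = 0"
    and commute: "d i k = d k i"
    and triangle: "\<lbrakk>i \<in> lattice N D; j \<in> lattice N D; k \<in> lattice N D\<rbrakk> \<Longrightarrow> d i k \<le> d i j + d j k"
begin

section \<open>Norms of displacements\<close>

definition shift_norm :: "(nat \<Rightarrow> nat) \<Rightarrow> real" where
  "shift_norm f = L2_set (\<lambda>i. d i (shift N D f i)) (lattice N D)"

lemma shift_norm_sq: "(shift_norm f)\<^sup>2 = (\<Sum>i\<in>lattice N D. (d i (shift N D f i))\<^sup>2)"
  by (simp add: shift_norm_def L2_set_def sum_nonneg)

lemma shift_norm_nonneg: "0 \<le> shift_norm f"
  by (simp add: shift_norm_def)

lemma shift_norm_zero: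
  assumes "\<And>a. a < D \<Longrightarrow> f a = 0"
  shows "shift_norm f = 0"
  using assms by (simp add: shift_norm_def L2_set_def shift_id same)

text \<open>Go from i to i + f + g through i + f and apply Minkowski; translation by f turns the
  second leg into the norm of g.\<close>

lemma shift_norm_add: "shift_norm (\<lambda>a. f a + g a) \<le> shift_norm f + shift_norm g"
proof -
  have "shift_norm (\<lambda>a. f a + g a)
    \<le> L2_set (\<lambda>i. d i (shift N D f i) + d (shift N D f i) (shift N D g (shift N D f i))) (lattice N D)"
    unfolding shift_norm_def
    by (rule L2_set_mono)
      (auto simp: nonneg shift_shift[symmetric] intro!: triangle shift_lattice N_pos)
  also have "\<dots> \<le> shift_norm f + L2_set (\<lambda>i. d (shift N D f i) (shift N D g (shift N D f i))) (lattice N D)"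
    unfolding shift_norm_def by (rule L2_set_triangle_ineq)
  also have "L2_set (\<lambda>i. d (shift N D f i) (shift N D g (shift N D f i))) (lattice N D) = shift_norm g"
    using sum_lattice_shift[OF N_pos, of "\<lambda>i. (d i (shift N D g i))\<^sup>2" D f]
    by (simp add: shift_norm_def L2_set_def)
  finally show ?thesis by simp
qed

lemma shift_norm_axis_le_mult:
  "shift_norm (axis_shift a m) \<le> real m * shift_norm (axis_shift a 1)"
proof (induction m)
  case 0
  then show ?case by (simp add: shift_norm_zero axis_shift_def)
next
  case (Suc m)
  have "axis_shift a (Suc m) = (\<lambda>b. axis_shift a m b + axis_shift a 1 b)"
    by (auto simp: axis_shift_def)
  then have "shift_norm (axis_shift a (Suc m)) \<le> shift_norm (axis_shift a m) + shift_norm (axis_shift a 1)"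
    using shift_norm_add by simp
  with Suc show ?case by (simp add: algebra_simps)
qed

text \<open>A step by \<open>m\<close> read backwards is a step by \<open>N - m\<close> from its
  endpoint; symmetry of \<open>d\<close> and translation invariance do the rest.\<close>

lemma shift_norm_axis_uminus:
  assumes "m \<le> N"
  shows "shift_norm (axis_shift a m) = shift_norm (axis_shift a (N - m))"
proof -
  have "shift N D (axis_shift a (N - m)) (shift N D (axis_shift a m) i) = i" if "i \<in> lattice N D" for i
    unfolding shift_shift by (rule shift_id[OF that]) (use assms in \<open>auto simp: axis_shift_def\<close>)
  then have "(\<Sum>i\<in>lattice N D. (d i (shift N D (axis_shift a m) i))\<^sup>2) =
    (\<Sum>i\<in>lattice N D. (d (shift N D (axis_shift a m) i)
      (shift N D (axis_shift a (N - m)) (shift N D (axis_shift a m) i)))\<^sup>2)"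
    by (intro sum.cong) (auto simp: commute)
  also have "\<dots> = (\<Sum>i\<in>lattice N D. (d i (shift N D (axis_shift a (N - m)) i))\<^sup>2)"
    by (rule sum_lattice_shift[OF N_pos])
  finally show ?thesis by (simp add: shift_norm_def L2_set_def)
qed

lemma shift_norm_axis_le:
  assumes "m \<le> N"
  shows "shift_norm (axis_shift a m) \<le> real (cyclic_abs N m) * shift_norm (axis_shift a 1)"
  using shift_norm_axis_le_mult[of a m] shift_norm_axis_le_mult[of a "N - m"] shift_norm_axis_uminus[OF assms]
  by (simp add: cyclic_abs_def min_def)

lemma shift_norm_le:
  assumes "f \<in> lattice N D"
  shows "shift_norm f \<le> (\<Sum>a<D. real (cyclic_abs N (f a)) * shift_norm (axis_shift a 1))"
proof -
  \<comment> \<open>The coordinates are switched on one at a time, each costing one displacement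
    along its axis.\<close>
  have "shift_norm (\<lambda>a. if a < n then f a else 0)
    \<le> (\<Sum>a<n. real (cyclic_abs N (f a)) * shift_norm (axis_shift a 1))" if "n \<le> D" for n
    using that
  proof (induction n)
    case 0
    then show ?case by (simp add: shift_norm_zero)
  next
    case (Suc n)
    have "(\<lambda>a. if a < Suc n then f a else 0) = (\<lambda>a. (if a < n then f a else 0) + axis_shift n (f n) a)"
      by (auto simp: axis_shift_def less_Suc_eq)
    then have "shift_norm (\<lambda>a. if a < Suc n then f a else 0)
      \<le> shift_norm (\<lambda>a. if a < n then f a else 0) + shift_norm (axis_shift n (f n))"
      using shift_norm_add by simp
    moreover have "f n \<le> N"
      using assms Suc.prems by (auto simp: lattice_def PiE_iff less_imp_le)
    ultimately show ?case
      using Suc shift_norm_axis_le[of "f n" n] by simp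
  qed
  from this[of D] have "shift_norm (\<lambda>a. if a < D then f a else 0)
    \<le> (\<Sum>a<D. real (cyclic_abs N (f a)) * shift_norm (axis_shift a 1))" by blast
  moreover have "shift N D (\<lambda>a. if a < D then f a else 0) = shift N D f"
    by (rule shift_cong) simp
  then have "shift_norm (\<lambda>a. if a < D then f a else 0) = shift_norm f"
    by (simp only: shift_norm_def)
  ultimately show ?thesis by simp
qed

lemma shift_norm_sq_le:
  assumes "f \<in> lattice N D"
  shows "(shift_norm f)\<^sup>2 \<le> (\<Sum>b<D. (shift_norm (axis_shift b 1))\<^sup>2 *
    (\<Sum>a<D. real (cyclic_abs N (f a)) * real (cyclic_abs N (f b))))"
proof -
  let ?l = "\<lambda>a. real (cyclic_abs N (f a))" and ?e = "\<lambda>a. shift_norm (axis_shift a 1)"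
  \<comment> \<open>Writing l as sqrt l * sqrt l puts the weights into Cauchy-Schwarz; after
    summation over \<open>f\<close>, every axis gets the same bound on its coefficient.\<close>
  have "(shift_norm f)\<^sup>2 \<le> (\<Sum>a<D. sqrt (?l a) * (sqrt (?l a) * ?e a))\<^sup>2"
    using shift_norm_le[OF assms] shift_norm_nonneg by (intro power_mono) (simp_all add: mult.assoc[symmetric])
  also have "\<dots> \<le> (\<Sum>a<D. (sqrt (?l a))\<^sup>2) * (\<Sum>a<D. (sqrt (?l a) * ?e a)\<^sup>2)"
    by (rule Cauchy_Schwarz_ineq_sum)
  also have "\<dots> = (\<Sum>b<D. (?e b)\<^sup>2 * (\<Sum>a<D. ?l a * ?l b))"
    by (simp add: power_mult_distrib sum_distrib_left sum_distrib_right mult_ac)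
  finally show ?thesis .
qed

lemma sum_dist_sq_le:
  assumes "D \<ge> 1"
  shows "(\<Sum>i\<in>lattice N D. \<Sum>k\<in>lattice N D. (d i k)\<^sup>2)
    \<le> ((3 * real D + 1) / 48 * real N ^ (D + 2) + real N ^ D / 6)
      * (\<Sum>b<D. \<Sum>i\<in>lattice N D. (d i (shift N D (axis_shift b 1) i))\<^sup>2)"
proof -
  let ?l = "\<lambda>m. real (cyclic_abs N m)" and ?e = "\<lambda>a. shift_norm (axis_shift a 1)"
  let ?L = "lattice N D"
  \<comment> \<open>The term \<open>a = b\<close> gives the second moment, about N^(D+2) / 12; each
    of the other D - 1 gives a product of two first moments, at most N^(D+2) / 16.\<close>
  have coef: "(\<Sum>f\<in>?L. \<Sum>a<D. ?l (f a) * ?l (f b))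
      \<le> (3 * real D + 1) / 48 * real N ^ (D + 2) + real N ^ D / 6" if "b < D" for b
  proof -
    have D1: "real N ^ (D - 1) * real N = real N ^ D"
      using assms power_Suc2[of "real N" "D - 1"] by simp
    have "(\<Sum>f\<in>?L. \<Sum>a<D. ?l (f a) * ?l (f b)) = (\<Sum>a<D. \<Sum>f\<in>?L. ?l (f a) * ?l (f b))"
      by (rule sum.swap)
    also have "\<dots> = (\<Sum>f\<in>?L. ?l (f b) ^ 2) + (\<Sum>a\<in>{..<D} - {b}. \<Sum>f\<in>?L. ?l (f a) * ?l (f b))"
      using that by (simp add: sum.remove[of _ b] power2_eq_square)
    also have "(\<Sum>f\<in>?L. ?l (f b) ^ 2) = real N ^ (D - 1) * (\<Sum>x<N. ?l x ^ 2)"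
      by (rule sum_lattice_coord[OF that])
    also have "\<dots> \<le> real N ^ (D - 1) * (real N ^ 3 / 12 + real N / 6)"
      by (intro mult_left_mono sum_cyclic_abs_le) simp
    also have "\<dots> = (real N ^ (D - 1) * real N) * real N ^ 2 / 12 + (real N ^ (D - 1) * real N) / 6"
      by (simp add: field_simps power2_eq_square power3_eq_cube)
    also have "\<dots> = real N ^ (D + 2) / 12 + real N ^ D / 6"
      unfolding D1 by (simp add: power_add power2_eq_square)
    also have "(\<Sum>a\<in>{..<D} - {b}. \<Sum>f\<in>?L. ?l (f a) * ?l (f b)) \<le> (\<Sum>a\<in>{..<D} - {b}. real N ^ (D + 2) / 16)"
    proof (rule sum_mono)
      fix a assume a: "a \<in> {..<D} - {b}"
      then have "D \<ge> 2" using that by (cases "a < b") auto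
      then have D2: "real N ^ (D - 2) * (real N * real N * real N * real N) = real N ^ (D + 2)"
        by (auto simp: le_iff_add power_add power2_eq_square)
      have "(\<Sum>f\<in>?L. ?l (f a) * ?l (f b)) = real N ^ (D - 2) * (\<Sum>x<N. ?l x) * (\<Sum>x<N. ?l x)"
        using a that by (intro sum_lattice_two_coords) auto
      also have "\<dots> \<le> real N ^ (D - 2) * (real N ^ 2 / 4) * (real N ^ 2 / 4)"
        by (intro mult_mono sum_cyclic_abs_le) (auto intro!: sum_nonneg mult_nonneg_nonneg)
      also have "\<dots> = real N ^ (D + 2) / 16"
        unfolding D2[symmetric] by (simp add: power2_eq_square)
      finally show "(\<Sum>f\<in>?L. ?l (f a) * ?l (f b)) \<le> real N ^ (D + 2) / 16" .
    qed
    also have "(\<Sum>a\<in>{..<D} - {b}. real N ^ (D + 2) / 16) = (real D - 1) * (real N ^ (D + 2) / 16)"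
      using that by (simp add: of_nat_diff)
    finally show ?thesis by (simp add: field_simps)
  qed
  have "(\<Sum>i\<in>?L. \<Sum>k\<in>?L. (d i k)\<^sup>2) = (\<Sum>i\<in>?L. \<Sum>f\<in>?L. (d i (shift N D f i))\<^sup>2)"
    by (rule sum.cong[OF refl]) (rule sum_lattice_displacement[OF N_pos, symmetric])
  also have "\<dots> = (\<Sum>f\<in>?L. (shift_norm f)\<^sup>2)"
    unfolding shift_norm_sq by (rule sum.swap)
  also have "\<dots> \<le> (\<Sum>f\<in>?L. \<Sum>b<D. (?e b)\<^sup>2 * (\<Sum>a<D. ?l (f a) * ?l (f b)))"
    by (rule sum_mono) (rule shift_norm_sq_le)
  also have "\<dots> = (\<Sum>b<D. (?e b)\<^sup>2 * (\<Sum>f\<in>?L. \<Sum>a<D. ?l (f a) * ?l (f b)))"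
    by (subst sum.swap) (simp only: sum_distrib_left)
  also have "\<dots> \<le> (\<Sum>b<D. (?e b)\<^sup>2 * ((3 * real D + 1) / 48 * real N ^ (D + 2) + real N ^ D / 6))"
    by (intro sum_mono mult_left_mono coef) auto
  also have "\<dots> = ((3 * real D + 1) / 48 * real N ^ (D + 2) + real N ^ D / 6) * (\<Sum>b<D. (?e b)\<^sup>2)"
    by (simp only: sum_distrib_right mult.commute)
  finally show ?thesis by (simp only: shift_norm_sq)
qed

end

section \<open>Edges\<close>

definition adjacent_pairs :: "nat \<Rightarrow> nat \<Rightarrow> ((nat \<Rightarrow> nat) \<times> (nat \<Rightarrow> nat)) set" where
  "adjacent_pairs N D = {(i, k). i \<in> lattice N D \<and> k \<in> lattice N D \<and> adjacent N D i k}"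

lemma adjacent_commute: "adjacent N D i k \<longleftrightarrow> adjacent N D k i"
proof -
  have "adjacent N D k i" if "adjacent N D i k" for i k
  proof -
    have "[int (i a) = int (k a) + 1] (mod int N) \<longleftrightarrow> [int (k a) = int (i a) - 1] (mod int N)"
      "[int (i a) = int (k a) - 1] (mod int N) \<longleftrightarrow> [int (k a) = int (i a) + 1] (mod int N)" for a
      by (auto simp: cong_iff_dvd_diff algebra_simps dvd_diff_commute)
    then show ?thesis using that unfolding adjacent_def by metis
  qed
  then show ?thesis by blast
qed

lemma finite_adjacent_pairs: "finite (adjacent_pairs N D)"
  by (rule finite_subset[of _ "lattice N D \<times> lattice N D"]) (auto simp: adjacent_pairs_def)

lemma finite_edges: "finite (edges N D)"
  by (rule finite_subset[of _ "Pow (lattice N D)"]) (auto simp: edges_def)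

text \<open>The ordered pair determines its edge as \<open>{v, w}\<close>, and each edge yields both
  orders, as in \<open>edge_dot\<close>.\<close>

lemma sum_edges:
  "(\<Sum>e\<in>edges N D. \<Sum>v\<in>e. \<Sum>w\<in>e - {v}. g v w) = (\<Sum>(v, w)\<in>adjacent_pairs N D. g v w)"
proof -
  have fin: "finite e" if "e \<in> edges N D" for e
    using that by (auto simp: edges_def)
  have "(\<Sum>e\<in>edges N D. \<Sum>v\<in>e. \<Sum>w\<in>e - {v}. g v w)
      = (\<Sum>e\<in>edges N D. \<Sum>(v, w)\<in>(SIGMA v:e. e - {v}). g v w)"
    by (rule sum.cong) (auto simp: sum.Sigma fin)
  also have "\<dots> = (\<Sum>(e, v, w)\<in>(SIGMA e:edges N D. SIGMA v:e. e - {v}). g v w)"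
    by (rule sum.Sigma) (auto simp: finite_edges fin)
  also have "\<dots> = (\<Sum>(v, w)\<in>adjacent_pairs N D. g v w)"
    by (rule sum.reindex_bij_witness[of _ "\<lambda>(v, w). ({v, w}, v, w)" snd])
      (auto simp: edges_def adjacent_pairs_def adjacent_commute, auto simp: adjacent_def)
  finally show ?thesis .
qed

lemma card_edges: "2 * card (edges N D) = card (adjacent_pairs N D)"
proof -
  have "(\<Sum>v\<in>e. \<Sum>w\<in>e - {v}. 1) = (2::nat)" if "e \<in> edges N D" for e
  proof -
    from that obtain i k where "e = {i, k}" "i \<noteq> k" by (auto simp: edges_def adjacent_def)
    then show ?thesis by (auto simp: card_Diff_singleton_if)
  qed
  then show ?thesis
    using sum_edges[of "\<lambda>_ _. 1 :: nat" N D] by (simp add: case_prod_unfold mult.commute)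
qed

text \<open>The factor 2 of the swap formula offsets the halving over ordered pairs, and
  \<open>E_star\<close> removes the constant. Thus division by \<open>4 * J\<close> leaves an
  expression free of \<open>J\<close>, whatever its sign.\<close>

lemma delta_H_eq_swap_sites:
  "delta_H J N D \<psi> s = of_real J * (\<Sum>(v, w)\<in>adjacent_pairs N D. \<psi> s - \<psi> (swap_sites v w s))"
proof -
  have "(\<Sum>e\<in>edges N D. edge_dot e \<psi> s) = (\<Sum>(v, w)\<in>adjacent_pairs N D. sigma_dot v w \<psi> s) / 2"
    unfolding edge_dot_def sum_edges[symmetric] by (simp add: sum_divide_distrib)
  also have "(\<Sum>(v, w)\<in>adjacent_pairs N D. sigma_dot v w \<psi> s)
      = (\<Sum>(v, w)\<in>adjacent_pairs N D. \<psi> s - 2 * (\<psi> s - \<psi> (swap_sites v w s)))"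
    by (rule sum.cong) (auto simp: sigma_dot_distinct adjacent_pairs_def adjacent_def)
  also have "\<dots> = of_nat (card (adjacent_pairs N D)) * \<psi> s
      - 2 * (\<Sum>(v, w)\<in>adjacent_pairs N D. \<psi> s - \<psi> (swap_sites v w s))"
    by (simp add: case_prod_unfold sum_subtractf sum_distrib_left)
  finally have e: "(\<Sum>e\<in>edges N D. edge_dot e \<psi> s)
      = of_nat (card (edges N D)) * \<psi> s - (\<Sum>(v, w)\<in>adjacent_pairs N D. \<psi> s - \<psi> (swap_sites v w s))"
    unfolding card_edges[symmetric] by (simp add: diff_divide_distrib)
  show ?thesis
    unfolding delta_H_def heisenberg_def E_star_def e by (simp add: algebra_simps)
qed

section \<open>Unit steps as ordered adjacent pairs\<close>

lemma adjacent_axis_shift: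
  assumes "N \<ge> 2" "i \<in> lattice N D" "a < D"
  shows "adjacent N D i (shift N D (axis_shift a 1) i)"
proof -
  let ?k = "shift N D (axis_shift a 1) i"
  have "[int (i a) = int (?k a) - 1] (mod int N)"
    using assms by (simp add: shift_def axis_shift_def cong_iff_dvd_diff zmod_int mod_eq_dvd_iff[symmetric] mod_simps)
  moreover have "i b = ?k b" if "b < D" "b \<noteq> a" for b
    using that assms by (auto simp: shift_def axis_shift_def lattice_def PiE_iff)
  moreover have "i a \<noteq> ?k a"
    using assms by (auto simp: shift_def axis_shift_def lattice_def PiE_iff mod_Suc)
  ultimately show ?thesis using assms unfolding adjacent_def by metis
qed

text \<open>Recovers the axis of a unit step from its two endpoints.\<close>

lemma axis_shift_neq:
  assumes "N \<ge> 2" "i \<in> lattice N D" "a < D"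
  shows "shift N D (axis_shift a 1) i b \<noteq> i b \<longleftrightarrow> b = a"
  using assms
  by (cases "b < D") (auto simp: shift_def axis_shift_def lattice_def PiE_iff mod_Suc extensional_def)

lemma axis_shift_inj:
  assumes "N \<ge> 2" "i \<in> lattice N D" "a < D" "b < D"
    and eq: "shift N D (axis_shift a (Suc 0)) i = shift N D (axis_shift b (Suc 0)) i"
  shows "a = b"
  using axis_shift_neq[OF assms(1,2,3), of a] axis_shift_neq[OF assms(1,2,4), of a] eq by simp

text \<open>Forward steps \<open>p\<close> and backward steps \<open>q\<close> both embed into the
  adjacent pairs. Their images are disjoint for N at least 3 and coincide for
  \<open>N = 2\<close>.\<close>

lemma sum_axis_shift_le:
  assumes "N \<ge> 2" and nonneg: "\<And>v w. 0 \<le> (g v w :: real)" and sym: "\<And>v w. g v w = g w v"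
  shows "(\<Sum>a<D. \<Sum>i\<in>lattice N D. g i (shift N D (axis_shift a 1) i)) \<le> (\<Sum>(v, w)\<in>adjacent_pairs N D. g v w)" (is "?S \<le> ?A")
    and "N \<ge> 3 \<Longrightarrow> 2 * (\<Sum>a<D. \<Sum>i\<in>lattice N D. g i (shift N D (axis_shift a 1) i)) \<le> (\<Sum>(v, w)\<in>adjacent_pairs N D. g v w)"
proof -
  let ?X = "{..<D} \<times> lattice N D"
  define p where "p = (\<lambda>(a, i). (i, shift N D (axis_shift a 1) i))"
  define q where "q = (\<lambda>(a, i). (shift N D (axis_shift a 1) i, i))"
  have inj: "inj_on p ?X" "inj_on q ?X"
    using axis_shift_inj[OF assms(1)] by (auto simp: inj_on_def p_def q_def)
  have sub: "p ` ?X \<subseteq> adjacent_pairs N D" "q ` ?X \<subseteq> adjacent_pairs N D"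
    using assms(1) adjacent_axis_shift[OF assms(1)]
    by (auto simp: p_def q_def adjacent_pairs_def adjacent_commute intro: shift_lattice)
  have p: "sum (case_prod g) (p ` ?X) = ?S"
    unfolding sum.reindex[OF inj(1)] by (simp add: sum.cartesian_product p_def case_prod_unfold)
  have q: "sum (case_prod g) (q ` ?X) = ?S"
    unfolding sum.reindex[OF inj(2)] by (simp add: sum.cartesian_product q_def case_prod_unfold sym)
  show "?S \<le> ?A"
    unfolding p[symmetric] by (rule sum_mono2) (auto simp: finite_adjacent_pairs sub nonneg)
  assume N3: "N \<ge> 3"
  have "p ` ?X \<inter> q ` ?X = {}"
  proof -
    have "p (a, i) \<noteq> q (b, k)" if "i \<in> lattice N D" "k \<in> lattice N D" "a < D" "b < D" for i k a b
    proof
      assume "p (a, i) = q (b, k)"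
      then have e: "i = shift N D (axis_shift b 1) k \<and> shift N D (axis_shift a 1) i = k"
        unfolding p_def q_def prod.case prod.inject .
      note eq = conjunct2[OF e, symmetric] conjunct1[OF e]
      have "a = b"
        using axis_shift_neq[OF assms(1) that(1,3), of a] axis_shift_neq[OF assms(1) that(2,4), of a] eq by metis
      \<comment> \<open>A forward step from \<open>i\<close> to \<open>k\<close> and one from
        \<open>k\<close> to \<open>i\<close> share their axis, so 2 would vanish mod
        \<open>N\<close>.\<close>
      then have "i = shift N D (\<lambda>c. axis_shift a 1 c + axis_shift a 1 c) i"
        by (metis eq shift_shift)
      from fun_cong[OF this, of a] have "i a = (i a + 2) mod N" "i a < N"
        using that(1,3) by (simp_all add: shift_def axis_shift_def lattice_def PiE_iff)
      then show False using N3
        by (cases "i a + 2 < N") (auto simp: mod_if split: if_splits)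
    qed
    then have "p u \<noteq> q v" if "u \<in> ?X" "v \<in> ?X" for u v
      using that by (metis SigmaE lessThan_iff)
    then show ?thesis by blast
  qed
  then have "2 * ?S = sum (case_prod g) (p ` ?X \<union> q ` ?X)"
    by (subst sum.union_disjoint) (auto simp: p q)
  also have "\<dots> \<le> ?A"
    by (rule sum_mono2) (use sub in \<open>auto simp: finite_adjacent_pairs nonneg\<close>)
  finally show "2 * ?S \<le> ?A" .
qed

section \<open>Comparison of the two forms and the operator inequality\<close>

lemma sum_swap_dist_sq_le:
  assumes "N \<ge> 2" "D \<ge> 1"
  shows "2 * (\<Sum>v\<in>lattice N D. \<Sum>w\<in>lattice N D. (swap_dist (lattice N D) \<psi> v w)\<^sup>2)
    \<le> ((3 * real D + 1) / 48 * real N ^ (D + 2) + real D * real N ^ (D + 1))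
      * (\<Sum>(v, w)\<in>adjacent_pairs N D. (swap_dist (lattice N D) \<psi> v w)\<^sup>2)"
    (is "2 * ?T \<le> ?c * ?A")
proof -
  interpret torus_pseudometric N D "swap_dist (lattice N D) \<psi>"
    using assms
    by unfold_locales (auto simp: swap_dist_nonneg swap_dist_same swap_dist_triangle intro: swap_dist_commute)
  define S where "S = (\<Sum>b<D. \<Sum>i\<in>lattice N D. (swap_dist (lattice N D) \<psi> i (shift N D (axis_shift b 1) i))\<^sup>2)"
  define k where "k = (3 * real D + 1) / 48 * real N ^ (D + 2) + real N ^ D / 6"
  have "S \<ge> 0" unfolding S_def by (intro sum_nonneg) auto
  have T: "?T \<le> k * S"
    unfolding k_def S_def by (rule sum_dist_sq_le[OF assms(2)])
  have SA: "S \<le> ?A" and SA3: "N \<ge> 3 \<Longrightarrow> 2 * S \<le> ?A"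
    unfolding S_def using assms
    by (intro sum_axis_shift_le; simp add: swap_dist_commute)+
  have "0 \<le> k" by (simp add: k_def)
  \<comment> \<open>For \<open>N = 2\<close> the steps \<open>i \<rightarrow> i + 1 \<rightarrow> i\<close> along an axis use the same edge, which loses a factor 2;
    the lower-order term of the constant absorbs it.\<close>
  have "2 * (k * S) \<le> ?c * ?A"
  proof (cases "N \<ge> 3")
    case True
    have "real N ^ D / 6 \<le> real D * real N ^ (D + 1)"
      using mult_mono[of 1 "real D * real N" "real N ^ D" "real N ^ D"] mult_mono[of 1 "real D" 1 "real N"] assms
      by simp
    then have "k \<le> ?c" by (simp add: k_def)
    then have "k * (2 * S) \<le> ?c * ?A"
      using SA3[OF True] \<open>0 \<le> k\<close> \<open>0 \<le> S\<close> by (intro mult_mono) auto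
    then show ?thesis by simp
  next
    case False
    then have "N = 2" using assms by simp
    then have "2 * k \<le> ?c"
      using assms mult_right_mono[of 1 "real D" "2 ^ D"] by (simp add: k_def field_simps)
    then have "(2 * k) * S \<le> ?c * ?A"
      using SA \<open>0 \<le> k\<close> \<open>0 \<le> S\<close> by (intro mult_mono) auto
    then show ?thesis by simp
  qed
  with T show ?thesis by linarith
qed

lemma sum_adjacent_pairs_if:
  "(\<Sum>(v, w)\<in>adjacent_pairs N D. g v w)
    = (\<Sum>v\<in>lattice N D. \<Sum>w\<in>lattice N D. if adjacent N D v w then g v w else 0)"
proof -
  have "adjacent_pairs N D = {p \<in> lattice N D \<times> lattice N D. adjacent N D (fst p) (snd p)}"
    by (auto simp: adjacent_pairs_def)
  then show ?thesis
    by (simp add: sum.inter_filter sum.cartesian_product case_prod_unfold)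
qed

theorem mainTheorem3:
  shows "\<exists>(K::real) (c::nat \<Rightarrow> nat \<Rightarrow> real). K > 0 \<and>
    (\<forall>N D. N \<ge> 2 \<longrightarrow> D \<ge> 1 \<longrightarrow>
       \<bar>c N D - (3 * real D + 1) / 48 * real N ^ (D + 2)\<bar> \<le> K * real D * real N ^ (D + 1)) \<and>
    (\<forall>N D. \<forall>J::real. N \<ge> 2 \<longrightarrow> D \<ge> 1 \<longrightarrow> J \<noteq> 0 \<longrightarrow>
       op_le (lattice N D) (delta_spin_sq N D)
         (\<lambda>\<psi> s. of_real (c N D) * (delta_H J N D \<psi> s / of_real (4 * J))))"
proof -
  \<comment> \<open>The error term is exactly D * N^(D+1), so K = 1 serves; it also covers the
    remainder N^D / 6 and the case \<open>N = 2\<close>.\<close>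
  define c where "c N D = (3 * real D + 1) / 48 * real N ^ (D + 2) + real D * real N ^ (D + 1)" for N D
  have "op_le (lattice N D) (delta_spin_sq N D)
      (\<lambda>\<psi> s. of_real (c N D) * (delta_H J N D \<psi> s / of_real (4 * J)))"
    if ND: "N \<ge> 2" "D \<ge> 1" and J: "J \<noteq> 0" for N D and J :: real
  proof -
    let ?L = "lattice N D"
    \<comment> \<open>Both operators become one weighted double sum over ordered pairs: c / 4 comes
      from the energy, and 1 / 2 from the spin.\<close>
    define m where "m v w = (if adjacent N D v w then c N D / 4 else 0) - 1 / 2" for v w
    \<comment> \<open>Stated over any real field, since it is used for real quadratic forms and for
      complex amplitudes.\<close>
    have split: "(\<Sum>v\<in>?L. \<Sum>w\<in>?L. of_real (m v w) * g v w)
        = of_real (c N D / 4) * (\<Sum>(v, w)\<in>adjacent_pairs N D. g v w) - (\<Sum>v\<in>?L. \<Sum>w\<in>?L. g v w) / 2"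
      for g :: "_ \<Rightarrow> _ \<Rightarrow> 'a :: real_field"
    proof -
      have "of_real (m v w) * g v w = of_real (c N D / 4) * (if adjacent N D v w then g v w else 0) - g v w / 2" for v w
        by (simp add: m_def algebra_simps)
      then show ?thesis
        by (simp add: sum_adjacent_pairs_if sum_subtractf sum_distrib_left sum_divide_distrib)
    qed
    have "positive_semidef ?L (\<lambda>\<psi> s. \<Sum>v\<in>?L. \<Sum>w\<in>?L. of_real (m v w) * (\<psi> s - \<psi> (swap_sites v w s)))"
    proof (rule positive_semidef_swap_sites)
      fix \<psi> :: "(nat \<Rightarrow> nat) state"
      show "0 \<le> (\<Sum>v\<in>?L. \<Sum>w\<in>?L. m v w * (swap_dist ?L \<psi> v w)\<^sup>2)"
        using sum_swap_dist_sq_le[OF ND, of \<psi>] split[of "\<lambda>v w. (swap_dist ?L \<psi> v w)\<^sup>2"]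
        by (simp add: c_def)
    qed
    moreover have "(\<lambda>\<psi> s. of_real (c N D) * (delta_H J N D \<psi> s / of_real (4 * J)) - delta_spin_sq N D \<psi> s)
        = (\<lambda>\<psi> s. \<Sum>v\<in>?L. \<Sum>w\<in>?L. of_real (m v w) * (\<psi> s - \<psi> (swap_sites v w s)))"
      unfolding split delta_spin_sq_def delta_H_eq_swap_sites card_lattice[of N D, symmetric]
        spin_sq_eq_swap_sites[OF finite_lattice]
      using J by simp
    ultimately show ?thesis by (simp add: op_le_def)
  qed
  moreover have "\<bar>c N D - (3 * real D + 1) / 48 * real N ^ (D + 2)\<bar> \<le> 1 * real D * real N ^ (D + 1)" for N D
    by (simp add: c_def)
  ultimately show ?thesis by (intro exI[of _ 1] exI[of _ c]) auto
qed

end
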